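(* Let $W\in\mathbb{N}$, $\alpha\in(0,1)$, $c\ge1/4$, and let $P_1,\dots,P_W$ be probability distributions on $[0,1]$ with mean vector $\mu=(\mu_1,\dots,\mu_W)$. Let $m=\mu$. For any sampling scheme $(\pi_t)_{t\in\mathbb{N}}$, the test $T_t(m,\alpha)$ has type-I error probability at most $\alpha$, i.e. $$\mathbb{P}\big(\exists t\in\mathbb{N}:\ T_t(m,\alpha)=1\big)\le\alpha .$$
   Context: $[W]=\{1,\dots,W\}$ indexes the arms. Data are collected sequentially: with $\mathcal{F}_{t}=\sigma((A_i,X_i)_{i=1}^{t})$ ($\mathcal F_0$ trivial), a sampling scheme is a sequence $(\pi_t)$ of $\mathcal{F}_{t-1}$-measurable elements of the probability simplex over $[W]$; at time $t$, $A_t$ is drawn from $\pi_t$ given $\mathcal{F}_{t-1}$, and given $\mathcal{F}_{t-1}$ and $A_t=a$ the outcome $X_t$ is drawn from $P_a$. Let $N_t(a)=\sum_{i=1}^t\mathbf{1}[A_i=a]$ and $\hat\mu_t(a)=\frac{1}{N_t(a)}\sum_{i=1}^t\mathbf{1}[A_i=a]X_i$; if $N_t(a)=0$, set $\hat\mu_t(a)=m_a$. For $m\in[0,1]^W$, $$K_t^a(m_a)=\prod_{i=1}^t\left(1-\mathbf{1}[A_i=a]+\mathbf{1}[A_i=a]\left(1+\frac{(\hat\mu_{i-1}(a)-m_a)(X_i-m_a)}{c}\right)\right),\qquad E_t(m)=\frac1W\sum_{a\in[W]}K_t^a(m_a),$$ and $T_t(m,\alpha)=\mathbf{1}\left[\max_{1\le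 i\le t}E_i(m)\ge1/\alpha\right]$. *)

theory Defs
  imports "HOL-Probability.Probability"
begin

(* history M A X t is the sigma-algebra generated by (A 1, X 1), ..., (A t, X t);
   for t = 0 it is trivial. *)
definition history ::
  "'w measure \<Rightarrow> (nat \<Rightarrow> 'w \<Rightarrow> nat) \<Rightarrow> (nat \<Rightarrow> 'w \<Rightarrow> real) \<Rightarrow> nat \<Rightarrow> 'w measure" where
  "history M A X t =
     vimage_algebra (space M) (\<lambda>\<omega>. \<lambda>i\<in>{1..t}. (A i \<omega>, X i \<omega>))
       (\<Pi>\<^sub>M i\<in>{1..t}. count_space UNIV \<Otimes>\<^sub>M borel)"

(* The sigma-algebra generated by the history up to time t - 1 together with the arm A t. *)
definition history_arm ::
  "'w measure \<Rightarrow> (nat \<Rightarrow> 'w \<Rightarrow> nat) \<Rightarrow> (nat \<Rightarrow> 'w \<Rightarrow> real) \<Rightarrow> nat \<Rightarrow> 'w measure" where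
  "history_arm M A X t =
     vimage_algebra (space M) (\<lambda>\<omega>. (\<lambda>i\<in>{1..t-1}. (A i \<omega>, X i \<omega>), A t \<omega>))
       ((\<Pi>\<^sub>M i\<in>{1..t-1}. count_space UNIV \<Otimes>\<^sub>M borel) \<Otimes>\<^sub>M count_space UNIV)"

(* Time starts at 1, so A 0, X 0 and p 0 are irrelevant. Since M is arbitrary, it may carry
   randomness beyond the data. *)
locale adaptive_sampling = prob_space M
  for M :: "'w measure"
    and W :: nat
    and P :: "nat \<Rightarrow> real measure"
    and p :: "nat \<Rightarrow> 'w \<Rightarrow> nat \<Rightarrow> real"
    and A :: "nat \<Rightarrow> 'w \<Rightarrow> nat"
    and X :: "nat \<Rightarrow> 'w \<Rightarrow> real" +
  assumes arm_measurable: "t \<ge> 1 \<Longrightarrow> A t \<in> measurable M (count_space {1..W})"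
    and outcome_measurable: "t \<ge> 1 \<Longrightarrow> X t \<in> borel_measurable M"
    and scheme_predictable:
      "t \<ge> 1 \<Longrightarrow> a \<in> {1..W} \<Longrightarrow> (\<lambda>\<omega>. p t \<omega> a) \<in> borel_measurable (history M A X (t - 1))"
    and scheme_nonneg: "t \<ge> 1 \<Longrightarrow> a \<in> {1..W} \<Longrightarrow> \<omega> \<in> space M \<Longrightarrow> p t \<omega> a \<ge> 0"
    and scheme_sum: "t \<ge> 1 \<Longrightarrow> \<omega> \<in> space M \<Longrightarrow> (\<Sum>a=1..W. p t \<omega> a) = 1"
    and arm_law:
      "t \<ge> 1 \<Longrightarrow> a \<in> {1..W} \<Longrightarrow>
         AE \<omega> in M. real_cond_exp M (history M A X (t - 1))
           (indicator {\<omega> \<in> space M. A t \<omega> = a}) \<omega> = p t \<omega> a"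
    and outcome_law:
      "t \<ge> 1 \<Longrightarrow> B \<in> sets borel \<Longrightarrow>
         AE \<omega> in M. real_cond_exp M (history_arm M A X t)
           (indicator {\<omega> \<in> space M. X t \<omega> \<in> B}) \<omega> = measure (P (A t \<omega>)) B"

definition arm_count :: "(nat \<Rightarrow> 'w \<Rightarrow> nat) \<Rightarrow> nat \<Rightarrow> nat \<Rightarrow> 'w \<Rightarrow> nat" where
  "arm_count A t a \<omega> = (\<Sum>i=1..t. of_bool (A i \<omega> = a))"

definition emp_mean ::
  "(nat \<Rightarrow> 'w \<Rightarrow> nat) \<Rightarrow> (nat \<Rightarrow> 'w \<Rightarrow> real) \<Rightarrow> (nat \<Rightarrow> real) \<Rightarrow> nat \<Rightarrow> nat \<Rightarrow> 'w \<Rightarrow> real" where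
  "emp_mean A X m t a \<omega> =
     (if arm_count A t a \<omega> = 0 then m a
      else 1 / real (arm_count A t a \<omega>) * (\<Sum>i=1..t. of_bool (A i \<omega> = a) * X i \<omega>))"

definition arm_wealth ::
  "real \<Rightarrow> (nat \<Rightarrow> 'w \<Rightarrow> nat) \<Rightarrow> (nat \<Rightarrow> 'w \<Rightarrow> real) \<Rightarrow> (nat \<Rightarrow> real) \<Rightarrow> nat \<Rightarrow> nat \<Rightarrow> 'w \<Rightarrow> real" where
  "arm_wealth c A X m t a \<omega> =
     (\<Prod>i=1..t. 1 - of_bool (A i \<omega> = a)
        + of_bool (A i \<omega> = a) * (1 + (emp_mean A X m (i - 1) a \<omega> - m a) * (X i \<omega> - m a) / c))"

definition e_process ::
  "nat \<Rightarrow> real \<Rightarrow> (nat \<Rightarrow> 'w \<Rightarrow> nat) \<Rightarrow> (nat \<Rightarrow> 'w \<Rightarrow> real) \<Rightarrow> (nat \<Rightarrow> real) \<Rightarrow> nat \<Rightarrow> 'w \<Rightarrow> real" where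
  "e_process W c A X m t \<omega> = 1 / real W * (\<Sum>a=1..W. arm_wealth c A X m t a \<omega>)"

(* Only meaningful for t \<ge> 1: for t = 0 the maximum is over the empty set. *)
definition e_test ::
  "nat \<Rightarrow> real \<Rightarrow> (nat \<Rightarrow> 'w \<Rightarrow> nat) \<Rightarrow> (nat \<Rightarrow> 'w \<Rightarrow> real) \<Rightarrow> (nat \<Rightarrow> real) \<Rightarrow> real \<Rightarrow> nat \<Rightarrow> 'w \<Rightarrow> nat" where
  "e_test W c A X m \<alpha> t \<omega> =
     of_bool (Max ((\<lambda>i. e_process W c A X m i \<omega>) ` {1..t}) \<ge> 1 / \<alpha>)"

(* Since measure is 0 on non-measurable sets, a bound on it says nothing for such sets;
   the rejection event is measurable. *)
lemma (in adaptive_sampling) rejection_event_measurable: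
  "{\<omega> \<in> space M. \<exists>t\<ge>1. e_test W c A X m \<alpha> t \<omega> = 1} \<in> events"
proof -
  have A [measurable]: "A i \<in> measurable M (count_space UNIV)" if "i \<ge> 1" for i
    using measurable_comp[OF arm_measurable[OF that], of id "count_space UNIV"] by simp
  note outcome_measurable [measurable]
  have n [measurable]: "arm_count A t a \<in> measurable M (count_space UNIV)" for t a
    unfolding arm_count_def of_bool_def by measurable
  have [measurable]: "emp_mean A X m t a \<in> borel_measurable M" for t a
    unfolding emp_mean_def of_bool_def by measurable
  have [measurable]: "arm_wealth c A X m t a \<in> borel_measurable M" for t a
    unfolding arm_wealth_def of_bool_def by measurable
  have [measurable]: "e_process W c A X m t \<in> borel_measurable M" for t
    unfolding e_process_def by measurable
  have "e_test W c A X m \<alpha> t \<omega> = 1 \<longleftrightarrow> (\<exists>i\<in>{1..t}. e_process W c A X m i \<omega> \<ge> 1 / \<alpha>)"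
    if "t \<ge> 1" for t \<omega>
    using that by (subst e_test_def) (auto simp: Max_ge_iff)
  hence "{\<omega> \<in> space M. \<exists>t\<ge>1. e_test W c A X m \<alpha> t \<omega> = 1} =
     {\<omega> \<in> space M. \<exists>t\<in>{1..}. \<exists>i\<in>{1..t}. e_process W c A X m i \<omega> \<ge> 1 / \<alpha>}"
    by auto
  also have "\<dots> \<in> events" by measurable
  finally show ?thesis .
qed

end

theory Submission
  imports Defs
begin

text \<open>Given the past and the arm \<open>A\<^sub>t = a\<close>, the outcome has mean \<open>m\<^sub>a\<close>, while the bet
  placed on it is already determined; hence every \<open>K\<^sup>a\<close>, and therefore their average \<open>E\<close>, is a
  martingale started at 1 whatever the sampling scheme. It is nonnegative because
  \<open>(x - m) (y - m) \<ge> -1/4 \<ge> -c\<close> on the unit interval, so Ville's inequality applies. As filtration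
  one can take the \<open>\<sigma>\<close>-algebras containing the next arm but not the next outcome; conditioning on
  the smaller \<open>\<sigma>\<close>-algebra of the history, and with it the law of the arms, is never needed.\<close>

section \<open>Ville's inequality for nonnegative supermartingales\<close>

text \<open>Stopping at the first visit to level b cannot raise the expectation, and a stopped path
  has value at least b. The supermartingale property is given by integrals over the sets of
  \<open>F n\<close>, so the proof only splits events and never forms a conditional
  expectation.\<close>

lemma (in prob_space) ville_finite:
  fixes Y :: "nat \<Rightarrow> 'a \<Rightarrow> real"
  assumes adapted: "\<And>i n. i \<le> n \<Longrightarrow> Y i \<in> borel_measurable (F n)"
    and subalg: "\<And>n. subalgebra M (F n)"
    and integrable: "\<And>n. integrable M (Y n)"
    and nonneg: "\<And>n. AE \<omega> in M. 0 \<le> Y n \<omega>"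
    and supermartingale: "\<And>n B. B \<in> sets (F n) \<Longrightarrow>
      (\<integral>\<omega>. indicator B \<omega> * Y (Suc n) \<omega> \<partial>M) \<le> (\<integral>\<omega>. indicator B \<omega> * Y n \<omega> \<partial>M)"
  shows "b * prob {\<omega> \<in> space M. \<exists>i\<le>n. b \<le> Y i \<omega>} \<le> expectation (Y 0)"
proof -
  define H where "H n = {\<omega> \<in> space M. \<exists>i\<le>n. b \<le> Y i \<omega>}" for n
  define N where "N n = {\<omega> \<in> space M. \<forall>i\<le>n. Y i \<omega> < b}" for n
  have [measurable]: "Y n \<in> borel_measurable M" for n
    using integrable[of n] by simp
  have H [measurable]: "H n \<in> events" for n
    unfolding H_def by measurable
  \<comment> \<open>Whether the path is still below b is decided at time n; this allows the
    supermartingale property to be applied on \<open>N n\<close>.\<close>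
  have N_F: "N n \<in> sets (F n)" for n
  proof -
    have sp: "space M = space (F n)"
      using subalg[of n] by (simp add: subalgebra_def)
    have [measurable]: "i \<in> {..n} \<Longrightarrow> Y i \<in> borel_measurable (F n)" for i
      using adapted[of i n] by simp
    have "N n = {\<omega> \<in> space (F n). \<forall>i\<in>{..n}. Y i \<omega> < b}"
      by (auto simp: N_def sp)
    also have "\<dots> \<in> sets (F n)" by measurable
    finally show ?thesis .
  qed
  have N [measurable]: "N n \<in> events" for n
    using N_F[of n] subalg[of n] by (auto simp: subalgebra_def)
  have int_ind: "integrable M (\<lambda>\<omega>. indicator B \<omega> * Y n \<omega>)" if "B \<in> events" for B n
    using integrable_mult_indicator[OF that integrable[of n]] by simp
  have hit: "b * prob B \<le> (\<integral>\<omega>. indicator B \<omega> * Y n \<omega> \<partial>M)"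
    if [measurable]: "B \<in> events" and "\<And>\<omega>. \<omega> \<in> B \<Longrightarrow> b \<le> Y n \<omega>" for B n
  proof -
    have "b * prob B = (\<integral>\<omega>. indicator B \<omega> * b \<partial>M)"
      by (simp add: mult.commute)
    also have "\<dots> \<le> (\<integral>\<omega>. indicator B \<omega> * Y n \<omega> \<partial>M)"
      using that by (intro integral_mono int_ind)
        (auto simp: emeasure_eq_measure split: split_indicator)
    finally show ?thesis .
  qed
  \<comment> \<open>The left side is a lower bound for the expectation of the process stopped at its
    first visit to [b, \<infinity>): paths that have hit count b, the others their current value.
    Keeping the second term makes the induction go through.\<close>
  have "b * prob (H n) + (\<integral>\<omega>. indicator (N n) \<omega> * Y n \<omega> \<partial>M) \<le> expectation (Y 0)"
  proof (induction n)
    case 0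
    have "(\<integral>\<omega>. indicator (H 0) \<omega> * Y 0 \<omega> \<partial>M) + (\<integral>\<omega>. indicator (N 0) \<omega> * Y 0 \<omega> \<partial>M)
        = (\<integral>\<omega>. indicator (H 0) \<omega> * Y 0 \<omega> + indicator (N 0) \<omega> * Y 0 \<omega> \<partial>M)"
      by (intro Bochner_Integration.integral_add[symmetric] int_ind) auto
    also have "\<dots> = expectation (Y 0)"
      by (intro Bochner_Integration.integral_cong) (auto simp: H_def N_def indicator_def)
    finally have "(\<integral>\<omega>. indicator (H 0) \<omega> * Y 0 \<omega> \<partial>M) +
        (\<integral>\<omega>. indicator (N 0) \<omega> * Y 0 \<omega> \<partial>M) = expectation (Y 0)" .
    moreover have "b * prob (H 0) \<le> (\<integral>\<omega>. indicator (H 0) \<omega> * Y 0 \<omega> \<partial>M)"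
      by (rule hit) (auto simp: H_def)
    ultimately show ?case by linarith
  next
    case (Suc n)
    \<comment> \<open>The paths whose first visit happens exactly at time \<open>Suc n\<close>. They
      move from the second term to the first, at the price of at most their value at that
      time.\<close>
    define D where "D = N n - N (Suc n)"
    have [measurable]: "D \<in> events" by (simp add: D_def)
    have "H (Suc n) = H n \<union> D" "H n \<inter> D = {}"
      by (auto simp: H_def N_def D_def le_Suc_eq not_less)
    hence "prob (H (Suc n)) = prob (H n) + prob D"
      by (simp add: finite_measure_Union)
    moreover have "b * prob D \<le> (\<integral>\<omega>. indicator D \<omega> * Y (Suc n) \<omega> \<partial>M)"
      by (rule hit) (auto simp: D_def N_def le_Suc_eq not_less)
    moreover have "(\<integral>\<omega>. indicator D \<omega> * Y (Suc n) \<omega> \<partial>M)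
        + (\<integral>\<omega>. indicator (N (Suc n)) \<omega> * Y (Suc n) \<omega> \<partial>M)
        = (\<integral>\<omega>. indicator D \<omega> * Y (Suc n) \<omega> + indicator (N (Suc n)) \<omega> * Y (Suc n) \<omega> \<partial>M)"
      by (intro Bochner_Integration.integral_add[symmetric] int_ind) auto
    moreover have "\<dots> = (\<integral>\<omega>. indicator (N n) \<omega> * Y (Suc n) \<omega> \<partial>M)"
      by (intro Bochner_Integration.integral_cong) (auto simp: D_def N_def indicator_def)
    moreover note supermartingale[OF N_F[of n]] Suc.IH
    ultimately show ?case by (simp add: distrib_left)
  qed
  \<comment> \<open>Nonnegativity lets the contribution of the paths not yet stopped be
    dropped.\<close>
  moreover have "0 \<le> (\<integral>\<omega>. indicator (N n) \<omega> * Y n \<omega> \<partial>M)"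
    using nonneg[of n] by (intro integral_nonneg_AE) (auto simp: indicator_def)
  ultimately show ?thesis by (simp add: H_def)
qed

text \<open>The events of a visit up to time n increase to the event of a visit at any time, and the
  finite bound does not depend on n; continuity from below gives the limit.\<close>

lemma (in prob_space) ville_inequality:
  fixes Y :: "nat \<Rightarrow> 'a \<Rightarrow> real"
  assumes adapted: "\<And>i n. i \<le> n \<Longrightarrow> Y i \<in> borel_measurable (F n)"
    and subalg: "\<And>n. subalgebra M (F n)"
    and integrable: "\<And>n. integrable M (Y n)"
    and nonneg: "\<And>n. AE \<omega> in M. 0 \<le> Y n \<omega>"
    and supermartingale: "\<And>n B. B \<in> sets (F n) \<Longrightarrow>
      (\<integral>\<omega>. indicator B \<omega> * Y (Suc n) \<omega> \<partial>M) \<le> (\<integral>\<omega>. indicator B \<omega> * Y n \<omega> \<partial>M)"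
  shows "b * prob {\<omega> \<in> space M. \<exists>i. b \<le> Y i \<omega>} \<le> expectation (Y 0)"
proof -
  define H where "H n = {\<omega> \<in> space M. \<exists>i\<le>n. b \<le> Y i \<omega>}" for n
  have [measurable]: "Y n \<in> borel_measurable M" for n
    using integrable[of n] by simp
  have "H n \<in> events" for n
    unfolding H_def by measurable
  hence "(\<lambda>n. prob (H n)) \<longlonglongrightarrow> prob (\<Union>n. H n)"
    by (intro finite_Lim_measure_incseq)
      (auto simp: H_def incseq_def intro: order_trans)
  hence "(\<lambda>n. b * prob (H n)) \<longlonglongrightarrow> b * prob (\<Union>n. H n)"
    by (intro tendsto_intros)
  hence "b * prob (\<Union>n. H n) \<le> expectation (Y 0)"
    by (rule LIMSEQ_le_const2) (use ville_finite[where F = F and Y = Y, OF assms] in \<open>auto simp: H_def\<close>)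
  moreover have "(\<Union>n. H n) = {\<omega> \<in> space M. \<exists>i. b \<le> Y i \<omega>}"
    by (auto simp: H_def)
  ultimately show ?thesis by simp
qed

section \<open>Measurability of the statistics\<close>

text \<open>This lemma and the next three concern an arbitrary N and only the times up to t, so that
  they serve both for M and for \<open>history_arm\<close>, which does not know the latest
  outcome.\<close>

lemma arm_count_measurable:
  assumes "\<And>i. i \<in> {1..t} \<Longrightarrow> A i \<in> measurable N (count_space UNIV)"
  shows "arm_count A t a \<in> measurable N (count_space UNIV)"
proof -
  note assms [measurable]
  show ?thesis unfolding arm_count_def of_bool_def by measurable
qed

lemma emp_mean_measurable:
  assumes "\<And>i. i \<in> {1..t} \<Longrightarrow> A i \<in> measurable N (count_space UNIV)"
    and "\<And>i. i \<in> {1..t} \<Longrightarrow> X i \<in> borel_measurable N"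
  shows "emp_mean A X m t a \<in> borel_measurable N"
proof -
  note assms [measurable] arm_count_measurable[OF assms(1), measurable]
  show ?thesis unfolding emp_mean_def of_bool_def by measurable
qed

lemma arm_wealth_measurable:
  assumes A: "\<And>i. i \<in> {1..t} \<Longrightarrow> A i \<in> measurable N (count_space UNIV)"
    and X: "\<And>i. i \<in> {1..t} \<Longrightarrow> X i \<in> borel_measurable N"
  shows "arm_wealth c A X m t a \<in> borel_measurable N"
proof -
  note A [measurable] X [measurable]
  have [measurable]: "emp_mean A X m (i - 1) a \<in> borel_measurable N" if "i \<in> {1..t}" for i
    by (rule emp_mean_measurable) (use that A X in auto)
  show ?thesis unfolding arm_wealth_def of_bool_def by measurable
qed

lemma e_process_measurable:
  assumes "\<And>i. i \<in> {1..t} \<Longrightarrow> A i \<in> measurable N (count_space UNIV)"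
    and "\<And>i. i \<in> {1..t} \<Longrightarrow> X i \<in> borel_measurable N"
  shows "e_process W c A X m t \<in> borel_measurable N"
proof -
  note arm_wealth_measurable[OF assms, measurable]
  show ?thesis unfolding e_process_def by measurable
qed

section \<open>Recursion and pathwise bounds for the wealth\<close>

text \<open>The increment is split into a stake fixed by the first t observations and a centered
  outcome, which is the only factor involving time \<open>Suc t\<close>.\<close>

lemma arm_wealth_Suc:
  "arm_wealth c A X m (Suc t) a \<omega> = arm_wealth c A X m t a \<omega> +
    arm_wealth c A X m t a \<omega> * (emp_mean A X m t a \<omega> - m a) / c *
      (of_bool (A (Suc t) \<omega> = a) * (X (Suc t) \<omega> - m a))"
  by (cases "A (Suc t) \<omega> = a") (simp_all add: arm_wealth_def distrib_left)

lemma emp_mean_unit_interval: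
  assumes "\<And>i. i \<in> {1..t} \<Longrightarrow> X i \<omega> \<in> {0..1}" and "m a \<in> {0..1}"
  shows "emp_mean A X m t a \<omega> \<in> {0..1}"
proof (cases "arm_count A t a \<omega> = 0")
  case False
  have "(\<Sum>i=1..t. of_bool (A i \<omega> = a) * X i \<omega>) \<le> (\<Sum>i=1..t. of_bool (A i \<omega> = a))"
    using assms(1) by (intro sum_mono) (auto simp: of_bool_def)
  also have "\<dots> = real (arm_count A t a \<omega>)"
    by (simp add: arm_count_def)
  finally show ?thesis
    using False assms(1) by (auto simp: emp_mean_def field_simps intro!: sum_nonneg)
qed (use assms in \<open>simp add: emp_mean_def\<close>)

text \<open>Polarization: with u = x - m and v = y - m, 4 u v = (u + v)^2 - (u - v)^2, and u - v = x
  - y has modulus at most 1. This is the source of the threshold 1/4 for c.\<close>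

lemma centered_mult_bounds:
  fixes x y m :: real
  assumes "x \<in> {0..1}" "y \<in> {0..1}" "m \<in> {0..1}"
  shows "- 1 / 4 \<le> (x - m) * (y - m)" and "(x - m) * (y - m) \<le> 1"
proof -
  have "\<bar>x - y\<bar> \<le> 1" using assms by auto
  hence "(x - y)\<^sup>2 \<le> 1" by (simp add: abs_square_le_1)
  moreover have "4 * ((x - m) * (y - m)) = (x + y - 2 * m)\<^sup>2 - (x - y)\<^sup>2"
    by (simp add: power2_eq_square algebra_simps)
  ultimately show "- 1 / 4 \<le> (x - m) * (y - m)"
    using zero_le_power2[of "x + y - 2 * m"] by linarith
  have "\<bar>x - m\<bar> \<le> 1" "\<bar>y - m\<bar> \<le> 1" using assms by auto
  hence "\<bar>x - m\<bar> * \<bar>y - m\<bar> \<le> 1 * 1" by (intro mult_mono) auto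
  thus "(x - m) * (y - m) \<le> 1" by (simp add: abs_mult[symmetric])
qed

text \<open>The lower bound is the nonnegativity needed for Ville's inequality; the upper bound is
  crude and serves only integrability.\<close>

lemma arm_wealth_bounds:
  assumes X: "\<And>i. i \<in> {1..t} \<Longrightarrow> X i \<omega> \<in> {0..1}" and m: "m a \<in> {0..1}" and c: "c \<ge> 1 / 4"
  shows "arm_wealth c A X m t a \<omega> \<in> {0..5 ^ t}"
proof -
  define f where "f i = 1 - of_bool (A i \<omega> = a) + of_bool (A i \<omega> = a) *
    (1 + (emp_mean A X m (i - 1) a \<omega> - m a) * (X i \<omega> - m a) / c)" for i
  have f: "0 \<le> f i \<and> f i \<le> 5" if "i \<in> {1..t}" for i
  proof -
    have "emp_mean A X m (i - 1) a \<omega> \<in> {0..1}"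
      using that by (intro emp_mean_unit_interval X m) auto
    note b = centered_mult_bounds[OF this X[OF that] m]
    \<comment> \<open>The product lies between -1/4 and 1, and c is at least 1/4, so the quotient
      lies between -1 and 4; hence the constant 5.\<close>
    have "0 \<le> 1 + (emp_mean A X m (i - 1) a \<omega> - m a) * (X i \<omega> - m a) / c"
      "(emp_mean A X m (i - 1) a \<omega> - m a) * (X i \<omega> - m a) / c \<le> 4"
      using b c by (auto simp: field_simps)
    thus ?thesis by (auto simp: f_def of_bool_def)
  qed
  have "arm_wealth c A X m t a \<omega> = (\<Prod>i=1..t. f i)"
    by (simp add: arm_wealth_def f_def)
  moreover have "(\<Prod>i=1..t. f i) \<le> (\<Prod>i=1..t. 5)"
    using f by (intro prod_mono) auto
  moreover have "0 \<le> (\<Prod>i=1..t. f i)"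
    using f by (intro prod_nonneg) auto
  ultimately show ?thesis by simp
qed

section \<open>The outcome given the history and the current arm\<close>

context adaptive_sampling
begin

lemma arm_measurable_UNIV:
  assumes "t \<ge> 1"
  shows "A t \<in> measurable M (count_space UNIV)"
  using measurable_comp[OF arm_measurable[OF assms], of id "count_space UNIV"] by simp

lemma subalgebra_history_arm:
  assumes "t \<ge> 1"
  shows "subalgebra M (history_arm M A X t)"
proof -
  let ?S = "(\<Pi>\<^sub>M i\<in>{1..t-1}. count_space UNIV \<Otimes>\<^sub>M borel) \<Otimes>\<^sub>M count_space UNIV ::
    ((nat \<Rightarrow> nat \<times> real) \<times> nat) measure"
  have [measurable]: "i \<in> {1..t-1} \<Longrightarrow> A i \<in> measurable M (count_space UNIV)"
    "i \<in> {1..t-1} \<Longrightarrow> X i \<in> borel_measurable M" for i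
    using arm_measurable_UNIV outcome_measurable by auto
  note [measurable] = arm_measurable_UNIV[OF assms]
  have "(\<lambda>\<omega>. (\<lambda>i\<in>{1..t-1}. (A i \<omega>, X i \<omega>), A t \<omega>)) \<in> measurable M ?S"
    by measurable
  from sets_image_in_sets[OF refl this] show ?thesis
    by (simp add: subalgebra_def history_arm_def)
qed

lemma sigma_finite_history_arm:
  assumes "t \<ge> 1"
  shows "sigma_finite_subalgebra M (history_arm M A X t)"
proof -
  interpret finite_measure_subalgebra M "history_arm M A X t"
    by unfold_locales (rule subalgebra_history_arm[OF assms])
  show ?thesis by unfold_locales
qed

text \<open>These variables are coordinates of the map that generates the \<sigma>-algebra. The arm
  of time t is among them, whereas outcomes stop at t - 1.\<close>

lemma history_arm_measurable:
  shows "A t \<in> measurable (history_arm M A X t) (count_space UNIV)"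
    and "i \<in> {1..<t} \<Longrightarrow> A i \<in> measurable (history_arm M A X t) (count_space UNIV)"
    and "i \<in> {1..<t} \<Longrightarrow> X i \<in> borel_measurable (history_arm M A X t)"
proof -
  let ?P = "\<Pi>\<^sub>M i\<in>{1..t-1}. count_space UNIV \<Otimes>\<^sub>M borel :: (nat \<times> real) measure"
  define h where "h \<omega> = (\<lambda>i\<in>{1..t-1}. (A i \<omega>, X i \<omega>), A t \<omega>)" for \<omega>
  have h [measurable]: "h \<in> measurable (history_arm M A X t) (?P \<Otimes>\<^sub>M count_space UNIV)"
    unfolding history_arm_def h_def
    by (rule measurable_vimage_algebra1) (auto simp: space_pair_measure space_PiM)
  have "(\<lambda>\<omega>. snd (h \<omega>)) \<in> measurable (history_arm M A X t) (count_space UNIV)"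
    by measurable
  thus "A t \<in> measurable (history_arm M A X t) (count_space UNIV)"
    by (simp add: h_def)
  assume i: "i \<in> {1..<t}"
  hence [measurable]: "i \<in> {1..t-1}" by auto
  have "(\<lambda>\<omega>. fst (fst (h \<omega>) i)) \<in> measurable (history_arm M A X t) (count_space UNIV)"
    "(\<lambda>\<omega>. snd (fst (h \<omega>) i)) \<in> borel_measurable (history_arm M A X t)"
    by measurable
  thus "A i \<in> measurable (history_arm M A X t) (count_space UNIV)"
    "X i \<in> borel_measurable (history_arm M A X t)"
    using \<open>i \<in> {1..t-1}\<close> by (simp_all add: h_def)
qed

text \<open>\<open>outcome_law\<close> integrated over G: since the arm is constant on G, the random
  law \<open>P (A t \<omega>)\<close> becomes the fixed law \<open>P a\<close> there.\<close>

lemma outcome_prob: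
  assumes t: "t \<ge> 1" and G: "G \<in> sets (history_arm M A X t)"
    and arm: "\<And>\<omega>. \<omega> \<in> G \<Longrightarrow> A t \<omega> = a" and B: "B \<in> sets borel"
  shows "prob (G \<inter> X t -` B) = prob G * measure (P a) B"
proof -
  interpret sigma_finite_subalgebra M "history_arm M A X t"
    by (rule sigma_finite_history_arm[OF t])
  let ?D = "{\<omega> \<in> space M. X t \<omega> \<in> B}"
  note outcome_measurable[OF t, measurable] B [measurable]
  have GM [measurable]: "G \<in> events"
    using G subalgebra_history_arm[OF t] by (auto simp: subalgebra_def)
  have D [measurable]: "?D \<in> events" by measurable
  have eq: "G \<inter> X t -` B = G \<inter> ?D"
    using sets.sets_into_space[OF GM] by auto
  have "prob (G \<inter> ?D) = (\<integral>\<omega>\<in>G. indicator ?D \<omega> \<partial>M)"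
    by (simp add: set_lebesgue_integral_def indicator_inter_arith[symmetric])
  also have "\<dots> = (\<integral>\<omega>\<in>G. real_cond_exp M (history_arm M A X t) (indicator ?D) \<omega> \<partial>M)"
    by (rule real_cond_exp_intA) (use G in \<open>auto simp: emeasure_eq_measure\<close>)
  also have "\<dots> = (\<integral>\<omega>. indicator G \<omega> * measure (P a) B \<partial>M)"
    unfolding set_lebesgue_integral_def
    using outcome_law[OF t B] arm
    by (intro integral_cong_AE) (auto simp: indicator_def)
  also have "\<dots> = prob G * measure (P a) B"
    by simp
  finally show ?thesis by (simp add: eq)
qed

text \<open>By \<open>outcome_prob\<close>, restricting M to G and pushing it forward along
  \<open>X t\<close> gives \<open>P a\<close> scaled by \<open>prob G\<close>. This equality of
  measures carries the statement about events over to means.\<close>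

lemma outcome_integral:
  assumes t: "t \<ge> 1" and G: "G \<in> sets (history_arm M A X t)"
    and arm: "\<And>\<omega>. \<omega> \<in> G \<Longrightarrow> A t \<omega> = a" and P: "real_distribution (P a)"
  shows "(\<integral>\<omega>. indicator G \<omega> * X t \<omega> \<partial>M) = prob G * (\<integral>x. x \<partial>P a)"
proof -
  interpret Pa: real_distribution "P a" by (rule P)
  note outcome_measurable[OF t, measurable]
  have GM [measurable]: "G \<in> events"
    using G subalgebra_history_arm[OF t] by (auto simp: subalgebra_def)
  have eq: "distr (density M (indicator G)) borel (X t) = density (P a) (\<lambda>_. ennreal (prob G))"
  proof (rule measure_eqI)
    fix B assume "B \<in> sets (distr (density M (indicator G)) borel (X t))"
    hence B [measurable]: "B \<in> sets borel" by simp
    have [simp]: "G \<inter> (X t -` B \<inter> space M) = G \<inter> X t -` B"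
      using sets.sets_into_space[OF GM] by auto
    have "emeasure (distr (density M (indicator G)) borel (X t)) B =
        emeasure M (G \<inter> (X t -` B \<inter> space M))"
      by (simp add: emeasure_distr emeasure_restricted del: Int_iff)
    also have "\<dots> = ennreal (prob G) * emeasure (P a) B"
      using outcome_prob[OF t G arm B]
      by (simp add: emeasure_eq_measure Pa.emeasure_eq_measure ennreal_mult)
    finally show "emeasure (distr (density M (indicator G)) borel (X t)) B =
        emeasure (density (P a) (\<lambda>_. ennreal (prob G))) B"
      by (simp add: emeasure_density_const)
  qed simp
  have "(\<integral>\<omega>. indicator G \<omega> * X t \<omega> \<partial>M) = (\<integral>\<omega>. X t \<omega> \<partial>density M (\<lambda>\<omega>. ennreal (indicator G \<omega>)))"
    by (subst integral_density) auto
  also have "\<dots> = (\<integral>x. x \<partial>distr (density M (indicator G)) borel (X t))"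
    by (subst integral_distr) (auto simp: ennreal_indicator)
  also have "\<dots> = prob G * (\<integral>x. x \<partial>P a)"
    unfolding eq by (subst integral_density) auto
  finally show ?thesis .
qed

text \<open>The centered outcome on the event that arm a is drawn has conditional expectation zero,
  so it is orthogonal to every multiplier Z known before the outcome. Integrability is asked of the
  product only, which is how the martingale increment supplies it.\<close>

lemma centered_outcome:
  assumes t: "t \<ge> 1" and P: "real_distribution (P a)" and int: "integrable M (X t)"
    and Z: "Z \<in> borel_measurable (history_arm M A X t)"
    and intZ: "integrable M (\<lambda>\<omega>. Z \<omega> * (of_bool (A t \<omega> = a) * (X t \<omega> - (\<integral>x. x \<partial>P a))))"
  shows "(\<integral>\<omega>. Z \<omega> * (of_bool (A t \<omega> = a) * (X t \<omega> - (\<integral>x. x \<partial>P a))) \<partial>M) = 0"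
proof -
  let ?H = "history_arm M A X t" and ?\<mu> = "\<integral>x. x \<partial>P a"
  let ?D = "\<lambda>\<omega>. of_bool (A t \<omega> = a) * (X t \<omega> - ?\<mu>)"
  interpret sigma_finite_subalgebra M ?H
    by (rule sigma_finite_history_arm[OF t])
  define C where "C = {\<omega> \<in> space ?H. A t \<omega> = a}"
  have sp: "space ?H = space M"
    using subalgebra_history_arm[OF t] by (simp add: subalgebra_def)
  have C [measurable]: "C \<in> sets ?H"
    unfolding C_def using history_arm_measurable(1)[of t] by measurable
  have HM: "B \<in> sets ?H \<Longrightarrow> B \<in> events" for B
    using subalgebra_history_arm[OF t] by (auto simp: subalgebra_def)
  have D_eq: "?D \<omega> = indicator C \<omega> * (X t \<omega> - ?\<mu>)" if "\<omega> \<in> space M" for \<omega>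
    using that by (auto simp: C_def sp indicator_def)
  have int_ind: "integrable M (\<lambda>\<omega>. indicator B \<omega> * (X t \<omega> - ?\<mu>))" if "B \<in> sets ?H" for B
    using integrable_mult_indicator[OF HM[OF that], of "\<lambda>\<omega>. X t \<omega> - ?\<mu>"] int by simp
  have intD: "integrable M ?D"
    using int_ind[OF C] by (subst Bochner_Integration.integrable_cong[OF refl D_eq]) auto
  \<comment> \<open>Test against sets B of the \<sigma>-algebra. C belongs to it because the arm is
    known, so \<open>outcome_integral\<close> applies to \<open>B \<inter> C\<close>.\<close>
  have "AE \<omega> in M. real_cond_exp M ?H ?D \<omega> = 0"
  proof (rule real_cond_exp_charact)
    fix B assume B: "B \<in> sets ?H"
    hence BC: "B \<inter> C \<in> sets ?H" by auto
    have "(\<integral>\<omega>\<in>B. ?D \<omega> \<partial>M) =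
        (\<integral>\<omega>. indicator (B \<inter> C) \<omega> * X t \<omega> - indicator (B \<inter> C) \<omega> * ?\<mu> \<partial>M)"
      unfolding set_lebesgue_integral_def
      by (intro Bochner_Integration.integral_cong) (auto simp: D_eq indicator_def)
    also have "\<dots> = (\<integral>\<omega>. indicator (B \<inter> C) \<omega> * X t \<omega> \<partial>M) - (\<integral>\<omega>. indicator (B \<inter> C) \<omega> * ?\<mu> \<partial>M)"
      using integrable_mult_indicator[OF HM[OF BC] int] HM[OF BC]
      by (intro Bochner_Integration.integral_diff) (auto simp: emeasure_eq_measure)
    also have "\<dots> = 0"
      using outcome_integral[OF t BC _ P] HM[OF BC] by (simp add: C_def)
    finally show "(\<integral>\<omega>\<in>B. ?D \<omega> \<partial>M) = (\<integral>\<omega>\<in>B. 0 \<partial>M)" by simp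
  qed (use intD in auto)
  hence "(\<integral>\<omega>. Z \<omega> * real_cond_exp M ?H ?D \<omega> \<partial>M) = (\<integral>\<omega>. 0 \<partial>M)"
    using Z subalgebra_history_arm[OF t]
    by (intro integral_cong_AE) (auto intro: measurable_from_subalg)
  thus ?thesis
    using real_cond_exp_intg(2)[OF intZ Z] intD by simp
qed

end

section \<open>Almost sure boundedness of the outcomes\<close>

locale unit_interval_sampling = adaptive_sampling +
  assumes arm_distribution: "a \<in> {1..W} \<Longrightarrow> real_distribution (P a)"
    and arm_unit_interval: "a \<in> {1..W} \<Longrightarrow> measure (P a) {0..1} = 1"
begin

text \<open>Whichever arm is drawn, its law gives the unit interval mass 1, so the conditional
  probability of landing there is almost surely 1; integrate it.\<close>

lemma AE_outcome_unit_interval: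
  assumes t: "t \<ge> 1"
  shows "AE \<omega> in M. X t \<omega> \<in> {0..1}"
proof -
  interpret sigma_finite_subalgebra M "history_arm M A X t"
    by (rule sigma_finite_history_arm[OF t])
  let ?D = "{\<omega> \<in> space M. X t \<omega> \<in> {0..1}}"
  note outcome_measurable[OF t, measurable]
  have unit: "{0..1::real} \<in> sets borel" by simp
  have "AE \<omega> in M. real_cond_exp M (history_arm M A X t) (indicator ?D) \<omega> = 1"
    using outcome_law[OF t unit] AE_space
  proof eventually_elim
    case (elim \<omega>)
    moreover have "A t \<omega> \<in> {1..W}"
      using measurable_space[OF arm_measurable[OF t]] elim by auto
    ultimately show ?case using arm_unit_interval by simp
  qed
  hence "(\<integral>\<omega>. real_cond_exp M (history_arm M A X t) (indicator ?D) \<omega> \<partial>M) = (\<integral>\<omega>. 1 \<partial>M)"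
    by (intro integral_cong_AE) auto
  moreover have "(\<integral>\<omega>. real_cond_exp M (history_arm M A X t) (indicator ?D) \<omega> \<partial>M) = prob ?D"
    by (subst real_cond_exp_int) (auto simp: emeasure_eq_measure)
  ultimately have "prob ?D = 1" by (simp add: prob_space)
  from AE_prob_1[OF this] show ?thesis by auto
qed

text \<open>A single null set for all times, since the pathwise bounds involve the whole
  past.\<close>

lemma AE_outcomes_unit_interval: "AE \<omega> in M. \<forall>t\<in>{1..}. X t \<omega> \<in> {0..1}"
  using AE_outcome_unit_interval by (intro AE_ball_countable[THEN iffD2]) auto

lemma integrable_outcome:
  assumes t: "t \<ge> 1"
  shows "integrable M (X t)"
  using AE_outcome_unit_interval[OF t] outcome_measurable[OF t]
  by (intro integrable_const_bound[of _ 1]) auto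

lemma arm_mean_unit_interval:
  assumes a: "a \<in> {1..W}"
  shows "(\<integral>x. x \<partial>P a) \<in> {0..1}"
proof -
  interpret Pa: real_distribution "P a" by (rule arm_distribution[OF a])
  have AE: "AE x in P a. x \<in> {0..1}"
    using Pa.AE_prob_1[OF arm_unit_interval[OF a]] .
  hence "integrable (P a) (\<lambda>x. x)"
    by (intro Pa.integrable_const_bound[of _ 1]) auto
  with AE show ?thesis
    by (auto intro!: Pa.integral_ge_const Pa.integral_le_const)
qed

end

section \<open>The martingale property and the maximal inequality for the e-process\<close>

locale e_process_sampling = unit_interval_sampling +
  fixes m :: "nat \<Rightarrow> real" and c :: real
  assumes mean: "a \<in> {1..W} \<Longrightarrow> m a = (\<integral>x. x \<partial>P a)"
    and c: "c \<ge> 1 / 4"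
begin

lemma AE_arm_wealth_bounds:
  assumes a: "a \<in> {1..W}"
  shows "AE \<omega> in M. arm_wealth c A X m t a \<omega> \<in> {0..5 ^ t}"
  using AE_outcomes_unit_interval
proof eventually_elim
  case (elim \<omega>)
  show ?case
    by (rule arm_wealth_bounds) (use elim arm_mean_unit_interval[OF a] mean[OF a] c in auto)
qed

lemma integrable_arm_wealth:
  assumes a: "a \<in> {1..W}"
  shows "integrable M (arm_wealth c A X m t a)"
  using AE_arm_wealth_bounds[OF a, of t]
  by (intro integrable_const_bound[of _ "5 ^ t"] arm_wealth_measurable)
    (auto intro: arm_measurable_UNIV outcome_measurable)

text \<open>By the recursion the difference of the two integrands is a multiplier known before the
  outcome times the centered outcome, so it integrates to zero.\<close>

lemma arm_wealth_martingale:
  assumes a: "a \<in> {1..W}" and B: "B \<in> sets (history_arm M A X (Suc t))"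
  shows "(\<integral>\<omega>. indicator B \<omega> * arm_wealth c A X m (Suc t) a \<omega> \<partial>M) =
    (\<integral>\<omega>. indicator B \<omega> * arm_wealth c A X m t a \<omega> \<partial>M)"
proof -
  let ?H = "history_arm M A X (Suc t)" and ?K = "\<lambda>t \<omega>. arm_wealth c A X m t a \<omega>"
  \<comment> \<open>The indicator of B is absorbed into the stake: both are measurable for the same
    \<sigma>-algebra.\<close>
  define Z where "Z \<omega> = indicator B \<omega> * (?K t \<omega> * (emp_mean A X m t a \<omega> - m a) / c)" for \<omega>
  let ?D = "\<lambda>\<omega>. Z \<omega> * (of_bool (A (Suc t) \<omega> = a) * (X (Suc t) \<omega> - m a))"
  have [measurable]: "?K t \<in> borel_measurable ?H" "emp_mean A X m t a \<in> borel_measurable ?H"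
    by (auto intro!: arm_wealth_measurable emp_mean_measurable history_arm_measurable)
  note B [measurable]
  have Z: "Z \<in> borel_measurable ?H"
    unfolding Z_def by measurable
  have BM: "B \<in> events"
    using B subalgebra_history_arm[of "Suc t"] by (auto simp: subalgebra_def)
  have K: "integrable M (\<lambda>\<omega>. indicator B \<omega> * ?K s \<omega>)" for s
    using integrable_mult_indicator[OF BM integrable_arm_wealth[OF a, of s]] by simp
  have D: "?D \<omega> = indicator B \<omega> * ?K (Suc t) \<omega> - indicator B \<omega> * ?K t \<omega>" for \<omega>
    by (simp add: Z_def arm_wealth_Suc algebra_simps)
  have "integrable M ?D"
    unfolding D by (intro Bochner_Integration.integrable_diff K)
  hence "(\<integral>\<omega>. ?D \<omega> \<partial>M) = 0"
    using centered_outcome[OF _ arm_distribution[OF a] integrable_outcome Z] by (simp add: mean[OF a])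
  thus ?thesis
    unfolding D by (subst (asm) Bochner_Integration.integral_diff) (use K in auto)
qed

lemma integral_e_process:
  assumes B: "B \<in> events"
  shows "(\<integral>\<omega>. indicator B \<omega> * e_process W c A X m t \<omega> \<partial>M) =
    1 / real W * (\<Sum>a=1..W. \<integral>\<omega>. indicator B \<omega> * arm_wealth c A X m t a \<omega> \<partial>M)"
proof -
  have "integrable M (\<lambda>\<omega>. indicator B \<omega> * arm_wealth c A X m t a \<omega>)" if "a \<in> {1..W}" for a
    using integrable_mult_indicator[OF B integrable_arm_wealth[OF that, of t]] by simp
  hence "(\<integral>\<omega>. 1 / real W * (\<Sum>a=1..W. indicator B \<omega> * arm_wealth c A X m t a \<omega>) \<partial>M) =
      1 / real W * (\<Sum>a=1..W. \<integral>\<omega>. indicator B \<omega> * arm_wealth c A X m t a \<omega> \<partial>M)"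
    by (subst integral_mult_right_zero, subst Bochner_Integration.integral_sum) auto
  moreover have "indicator B \<omega> * e_process W c A X m t \<omega> =
      1 / real W * (\<Sum>a=1..W. indicator B \<omega> * arm_wealth c A X m t a \<omega>)" for \<omega>
    by (simp add: e_process_def sum_distrib_left[symmetric])
  ultimately show ?thesis by simp
qed

lemma e_process_ville:
  assumes W: "W \<ge> 1"
  shows "b * prob {\<omega> \<in> space M. \<exists>t. b \<le> e_process W c A X m t \<omega>} \<le> 1"
proof -
  let ?E = "e_process W c A X m"
  have "b * prob {\<omega> \<in> space M. \<exists>t. b \<le> ?E t \<omega>} \<le> expectation (?E 0)"
  \<comment> \<open>The shift by one matters: \<open>history_arm M A X (Suc n)\<close> holds the
    outcomes up to time n, which determine \<open>?E n\<close> together with the arms, but not the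
    outcome that \<open>?E (Suc n)\<close> adds.\<close>
  proof (rule ville_inequality[where F = "\<lambda>n. history_arm M A X (Suc n)"])
    show "?E i \<in> borel_measurable (history_arm M A X (Suc n))" if "i \<le> n" for i n
      using that by (intro e_process_measurable history_arm_measurable) auto
    show "subalgebra M (history_arm M A X (Suc n))" for n
      by (rule subalgebra_history_arm) simp
    show "integrable M (?E n)" for n
      unfolding e_process_def
      by (intro integrable_mult_right Bochner_Integration.integrable_sum integrable_arm_wealth)
    show "AE \<omega> in M. 0 \<le> ?E n \<omega>" for n
    proof -
      have "AE \<omega> in M. \<forall>a\<in>{1..W}. arm_wealth c A X m n a \<omega> \<in> {0..5 ^ n}"
        by (intro AE_finite_allI AE_arm_wealth_bounds) auto
      thus ?thesis
        by eventually_elim (auto simp: e_process_def intro!: divide_nonneg_nonneg sum_nonneg)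
    qed
    show "(\<integral>\<omega>. indicator B \<omega> * ?E (Suc n) \<omega> \<partial>M) \<le> (\<integral>\<omega>. indicator B \<omega> * ?E n \<omega> \<partial>M)"
      if B: "B \<in> sets (history_arm M A X (Suc n))" for n B
    proof -
      have "B \<in> events"
        using B subalgebra_history_arm[of "Suc n"] by (auto simp: subalgebra_def)
      thus ?thesis
        by (simp add: integral_e_process arm_wealth_martingale[OF _ B])
    qed
  qed
  \<comment> \<open>Empty products: every arm starts with wealth 1, and the average over W \<ge> 1
    arms is 1.\<close>
  also have "?E 0 = (\<lambda>_. 1)"
    using W by (simp add: fun_eq_iff e_process_def arm_wealth_def)
  finally show ?thesis by (simp add: prob_space)
qed

end

section \<open>The type-I error of the test\<close>

theorem theorem3:
  fixes M :: "'w measure"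
    and W :: nat
    and \<alpha> c :: real
    and P :: "nat \<Rightarrow> real measure"
    and \<mu> m :: "nat \<Rightarrow> real"
    and \<pi> :: "nat \<Rightarrow> 'w \<Rightarrow> nat \<Rightarrow> real"
    and A :: "nat \<Rightarrow> 'w \<Rightarrow> nat"
    and X :: "nat \<Rightarrow> 'w \<Rightarrow> real"
  assumes "W \<ge> 1"
    and "0 < \<alpha>" and "\<alpha> < 1"
    and "c \<ge> 1 / 4"
    and "\<And>a. a \<in> {1..W} \<Longrightarrow> real_distribution (P a)"
    and "\<And>a. a \<in> {1..W} \<Longrightarrow> measure (P a) {0..1} = 1"
    and "\<And>a. a \<in> {1..W} \<Longrightarrow> \<mu> a = (\<integral>x. x \<partial>P a)"
    and "\<And>a. a \<in> {1..W} \<Longrightarrow> m a = \<mu> a"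
    and "adaptive_sampling M W P \<pi> A X"
  shows "\<P>(\<omega> in M. \<exists>t\<ge>1. e_test W c A X m \<alpha> t \<omega> = 1) \<le> \<alpha>"
proof -
  interpret adaptive_sampling M W P \<pi> A X by (rule assms)
  interpret e_process_sampling M W P \<pi> A X m c
  proof (intro e_process_sampling.intro e_process_sampling_axioms.intro
      unit_interval_sampling.intro unit_interval_sampling_axioms.intro)
    show "m a = (\<integral>x. x \<partial>P a)" if "a \<in> {1..W}" for a
      using assms(7,8)[OF that] by (rule trans[rotated])
  qed (fact assms)+
  let ?E = "e_process W c A X m"
  have [measurable]: "?E t \<in> borel_measurable M" for t
    by (intro e_process_measurable arm_measurable_UNIV outcome_measurable) auto
  have "e_test W c A X m \<alpha> t \<omega> = 1 \<longleftrightarrow> (\<exists>i\<in>{1..t}. 1 / \<alpha> \<le> ?E i \<omega>)" if "t \<ge> 1" for t \<omega>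
    using that unfolding e_test_def by (subst Max_ge_iff) auto
  \<comment> \<open>An inclusion suffices: the test looks at times from 1 on, whereas the maximal
    inequality also covers time 0.\<close>
  hence "{\<omega> \<in> space M. \<exists>t\<ge>1. e_test W c A X m \<alpha> t \<omega> = 1} \<subseteq>
      {\<omega> \<in> space M. \<exists>t. 1 / \<alpha> \<le> ?E t \<omega>}"
    by auto
  hence "\<P>(\<omega> in M. \<exists>t\<ge>1. e_test W c A X m \<alpha> t \<omega> = 1) \<le> prob {\<omega> \<in> space M. \<exists>t. 1 / \<alpha> \<le> ?E t \<omega>}"
    by (rule finite_measure_mono) measurable
  also have "\<dots> \<le> \<alpha>"
    using e_process_ville[OF \<open>W \<ge> 1\<close>, of "1 / \<alpha>"] \<open>0 < \<alpha>\<close> by (simp add: field_simps)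
  finally show ?thesis .
qed

end
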